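(* Let $r_h>0$, let $\omega\in\mathrm{BHO}(r_h)$ be a weight on $\mathbb{D}$, let $\mu=\omega\,dA$, and let $0<r_1<r_0$. Then the truncated maximal operator $M_{r_1,r_0}$ is bounded on $L^p(\mu)$ for every $1<p<\infty$ and is of weak type $(1,1)$ with respect to $\mu$ (i.e. there is $C>0$ with $\mu(\{z\in\mathbb{D}:M_{r_1,r_0}g(z)>\lambda\})\le\frac{C}{\lambda}\|g\|_{L^1(\mu)}$ for all $g\in L^1(\mu)$, $\lambda>0$).
   Context: $\mathbb{D}$ is the open unit disk in $\mathbb{C}$; $dA=\frac1\pi r\,dr\,d\theta$; a weight $\omega$ is a positive measurable function on $\mathbb{D}$. $\rho_h(z,w)=2\operatorname{artanh}\left|\frac{z-w}{1-\overline{z}w}\right|$ is the hyperbolic distance on $\mathbb{D}$ and $B_{\rho_h}(z,r)$ the hyperbolic ball of center $z$ and radius $r$. Bounded hyperbolic oscillation: $\omega\in\mathrm{BHO}(r_h)$ if there is a constant $\Lambda$ with $\sup_{z\in\mathbb{D}}\sup_{w,w'\in B_{\rho_h}(z,r_h)}\frac{\omega(w)}{\omega(w')}\le\Lambda$. Truncated maximal operator: for locally integrable $g$ on $\mathbb{D}$, $$M_{r_1,r_0}g(z)=\sup_{r_1<s\le r_0}\frac{1}{\mu(B_{\rho_h}(z,s))}\int_{B_{\rho_h}(z,s)}|g(\zeta)|\,d\mu(\zeta).$$ *)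

theory Defs
  imports "HOL-Analysis.Analysis"
begin

section \<open>Hyperbolic geometry of the unit disk\<close>

abbreviation unit_disk :: "complex set" where
  "unit_disk \<equiv> ball 0 1"

definition hyp_dist :: "complex \<Rightarrow> complex \<Rightarrow> real" where
  "hyp_dist z w = 2 * artanh (norm ((z - w) / (1 - cnj z * w)))"

definition hyp_ball :: "complex \<Rightarrow> real \<Rightarrow> complex set" where
  "hyp_ball z r = {w \<in> unit_disk. hyp_dist z w < r}"

section \<open>Weights of bounded hyperbolic oscillation\<close>

definition disk_weight :: "(complex \<Rightarrow> real) \<Rightarrow> bool" where
  "disk_weight \<omega> \<longleftrightarrow> \<omega> \<in> borel_measurable (lebesgue_on unit_disk) \<and> (\<forall>z\<in>unit_disk. 0 < \<omega> z)"

definition BHO :: "real \<Rightarrow> (complex \<Rightarrow> real) set" where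
  "BHO r = {\<omega>. \<exists>\<Lambda>. \<forall>z\<in>unit_disk. \<forall>w\<in>hyp_ball z r. \<forall>w'\<in>hyp_ball z r. \<omega> w / \<omega> w' \<le> \<Lambda>}"

text \<open>Normalised area: \<open>dA = (1 / pi) r dr d\<theta>\<close>, so that the disk has measure 1.\<close>

definition disk_area :: "complex measure" where
  "disk_area = scale_measure (ennreal (1 / pi)) (lebesgue_on unit_disk)"

definition weighted_area :: "(complex \<Rightarrow> real) \<Rightarrow> complex measure" where
  "weighted_area \<omega> = density disk_area (\<lambda>z. ennreal (\<omega> z))"

section \<open>The truncated maximal operator\<close>

text \<open>Averages and suprema are taken in \<^typ>\<open>ennreal\<close>, so no default value is attached to a
  divergent integral or an unbounded supremum.\<close>

definition trunc_maximal ::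
  "complex measure \<Rightarrow> real \<Rightarrow> real \<Rightarrow> (complex \<Rightarrow> complex) \<Rightarrow> complex \<Rightarrow> ennreal" where
  "trunc_maximal \<mu> r1 r0 g z =
     (SUP s\<in>{r1<..r0}. (\<integral>\<^sup>+\<zeta>\<in>hyp_ball z s. ennreal (norm (g \<zeta>)) \<partial>\<mu>) / emeasure \<mu> (hyp_ball z s))"

section \<open>Boundedness on \<open>L^p\<close> and weak type (1,1)\<close>

text \<open>Only used for exponents \<open>p > 0\<close>.\<close>

definition ennreal_powr :: "ennreal \<Rightarrow> real \<Rightarrow> ennreal" where
  "ennreal_powr x p = (if x = top then top else ennreal (enn2real x powr p))"

definition Lp_enorm :: "'a measure \<Rightarrow> real \<Rightarrow> ('a \<Rightarrow> ennreal) \<Rightarrow> ennreal" where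
  "Lp_enorm M p f = ennreal_powr (\<integral>\<^sup>+x. ennreal_powr (f x) p \<partial>M) (1 / p)"

definition Lp_space :: "'a measure \<Rightarrow> real \<Rightarrow> ('a \<Rightarrow> complex) set" where
  "Lp_space M p = {g \<in> borel_measurable M. Lp_enorm M p (\<lambda>x. ennreal (norm (g x))) < top}"

text \<open>Measurability of \<open>T g\<close> is part of both notions below: for non-measurable arguments
  \<^const>\<open>nn_integral\<close> is merely a lower integral and \<^const>\<open>emeasure\<close> is 0.\<close>

definition bounded_on_Lp ::
  "'a measure \<Rightarrow> real \<Rightarrow> (('a \<Rightarrow> complex) \<Rightarrow> 'a \<Rightarrow> ennreal) \<Rightarrow> bool" where
  "bounded_on_Lp M p T \<longleftrightarrow>
     (\<exists>C>0. \<forall>g\<in>Lp_space M p. T g \<in> borel_measurable M \<and>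
        Lp_enorm M p (T g) \<le> ennreal C * Lp_enorm M p (\<lambda>x. ennreal (norm (g x))))"

definition weak_type_1_1 ::
  "'a measure \<Rightarrow> (('a \<Rightarrow> complex) \<Rightarrow> 'a \<Rightarrow> ennreal) \<Rightarrow> bool" where
  "weak_type_1_1 M T \<longleftrightarrow>
     (\<exists>C>0. \<forall>g\<in>Lp_space M 1. T g \<in> borel_measurable M \<and>
        (\<forall>t>0. emeasure M {z \<in> space M. ennreal t < T g z} \<le>
           ennreal (C / t) * Lp_enorm M 1 (\<lambda>x. ennreal (norm (g x)))))"

end

theory Submission
  imports Defs
begin

text \<open>
  The lower truncation \<open>s > r\<^sub>1\<close> reduces everything to one averaging operator: by Jensen's inequality,
  \<open>(M g z)\<^sup>p \<le> \<mu>(B(z, r\<^sub>1))\<^sup>-\<^sup>1 \<integral> |g|\<^sup>p d\<mu>\<close>, the integral being over \<open>B(z, r\<^sub>0)\<close>.  This operator is bounded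
  on \<open>L\<^sup>1(\<mu>)\<close> by Tonelli's theorem as soon as \<open>\<mu>(B(w, r\<^sub>0)) \<le> C \<mu>(B(z, r\<^sub>1))\<close> whenever \<open>z \<in> B(w, r\<^sub>0)\<close>; hence
  the strong bounds for \<open>p > 1\<close>, and even for \<open>p = 1\<close>, which gives the weak type by Markov's inequality.
  For the comparison of measures, a hyperbolic ball of fixed radius about \<open>z\<close> contains, and is contained
  in, Euclidean disks about \<open>z\<close> of radius comparable to \<open>1 - |z|\<close>; so points at bounded hyperbolic distance
  are joined by a bounded number of short steps along the Euclidean segment, and \<open>\<omega>\<close> changes by at most
  the factor \<open>\<Lambda>\<close> in each.
\<close>

section \<open>Hyperbolic balls\<close>

text \<open>Since 2 artanh x = ln ((1 + x) / (1 - x)), a bound on \<open>hyp_dist\<close> becomes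
  one on the pseudohyperbolic distance. Any real \<open>s\<close> is allowed, so balls of
  nonpositive radius are covered as well.\<close>

lemma artanh_less_iff:
  fixes x s :: real
  assumes "\<bar>x\<bar> < 1"
  shows "2 * artanh x < s \<longleftrightarrow> x < tanh (s / 2)"
proof -
  have "2 * artanh x < s \<longleftrightarrow> ln ((1 + x) / (1 - x)) < s"
    by (simp add: artanh_def)
  also have "\<dots> \<longleftrightarrow> (1 + x) / (1 - x) < exp s"
    using assms exp_less_cancel_iff[of "ln ((1 + x) / (1 - x))" s] by simp
  also have "\<dots> \<longleftrightarrow> x < tanh (s / 2)"
  proof -
    have "(1 - inverse e) / (1 + inverse e) = (e - 1) / (e + 1)" if "0 < e" for e :: real
    proof -
      have "1 - inverse e = (e - 1) / e" "1 + inverse e = (e + 1) / e"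
        using that by (simp_all add: field_simps)
      then show ?thesis using that by simp
    qed
    then have tanh_eq: "tanh (s / 2) = (exp s - 1) / (exp s + 1)"
      by (simp add: tanh_real_altdef exp_minus)
    have "0 < exp s + 1" by (simp add: add_pos_pos)
    moreover have "0 < 1 - x" using assms by linarith
    ultimately show ?thesis unfolding tanh_eq by (simp add: field_simps)
  qed
  finally show ?thesis .
qed

text \<open>The difference of the squares factors as (1 - |z|^2) (1 - |w|^2), which is positive in
  the disk. This keeps the argument of \<open>artanh\<close> below 1.\<close>

lemma norm_diff_less_norm_one_minus_cnj_mult:
  assumes "z \<in> unit_disk" "w \<in> unit_disk"
  shows "norm (z - w) < norm (1 - cnj z * w)"
proof -
  have "(norm (1 - cnj z * w))\<^sup>2 - (norm (z - w))\<^sup>2 = (1 - (norm z)\<^sup>2) * (1 - (norm w)\<^sup>2)"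
    unfolding cmod_power2 by (simp add: power2_eq_square algebra_simps)
  moreover have "(norm z)\<^sup>2 < 1" "(norm w)\<^sup>2 < 1"
    using assms by (simp_all add: abs_square_less_1)
  ultimately have "(norm (z - w))\<^sup>2 < (norm (1 - cnj z * w))\<^sup>2"
    by (smt (verit) mult_pos_pos)
  then show ?thesis by (rule power2_less_imp_less) simp
qed

text \<open>Free of \<open>artanh\<close> and of division, this form is a strict inequality between
  functions continuous in both variables.\<close>

lemma mem_hyp_ball_iff:
  assumes "z \<in> unit_disk"
  shows "w \<in> hyp_ball z s \<longleftrightarrow> w \<in> unit_disk \<and> norm (z - w) < tanh (s / 2) * norm (1 - cnj z * w)"
proof (cases "w \<in> unit_disk")
  case True
  have lt: "norm (z - w) < norm (1 - cnj z * w)"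
    using norm_diff_less_norm_one_minus_cnj_mult[OF assms True] .
  then have pos: "0 < norm (1 - cnj z * w)" by (meson norm_ge_zero order_le_less_trans)
  have "hyp_dist z w < s \<longleftrightarrow> norm ((z - w) / (1 - cnj z * w)) < tanh (s / 2)"
    unfolding hyp_dist_def using lt pos by (intro artanh_less_iff) (simp add: norm_divide divide_simps)
  with pos True show ?thesis by (simp add: hyp_ball_def norm_divide divide_simps)
qed (simp add: hyp_ball_def)

lemma hyp_ball_sym:
  assumes "z \<in> unit_disk" "w \<in> hyp_ball z s"
  shows "z \<in> hyp_ball w s"
proof -
  have "norm (1 - cnj z * w) = norm (1 - cnj w * z)"
    by (metis complex_cnj_cnj complex_cnj_diff complex_cnj_mult complex_cnj_one complex_mod_cnj mult.commute)
  with assms show ?thesis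
    by (auto simp: hyp_ball_def hyp_dist_def norm_divide norm_minus_commute)
qed

lemma center_in_hyp_ball: "z \<in> unit_disk \<Longrightarrow> 0 < s \<Longrightarrow> z \<in> hyp_ball z s"
  by (simp add: hyp_ball_def hyp_dist_def)

lemma hyp_ball_mono: "s \<le> t \<Longrightarrow> hyp_ball z s \<subseteq> hyp_ball z t"
  by (auto simp: hyp_ball_def)

lemma hyp_ball_subset_disk: "hyp_ball z s \<subseteq> unit_disk"
  by (auto simp: hyp_ball_def)

text \<open>Openness jointly in center and point serves the measurability arguments on the product
  space; openness of a single ball follows by taking sections.\<close>

lemma open_hyp_ball_pairs: "open {(z, w). z \<in> unit_disk \<and> w \<in> hyp_ball z s}"
proof -
  have "{(z, w). z \<in> unit_disk \<and> w \<in> hyp_ball z s} =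
      {x. norm (fst x) < 1} \<inter> {x. norm (snd x) < 1} \<inter>
      {x. norm (fst x - snd x) < tanh (s / 2) * norm (1 - cnj (fst x) * snd x)}"
    using mem_hyp_ball_iff by (auto simp del: norm_mult)
  moreover have "open \<dots>"
    by (intro open_Int open_Collect_less continuous_intros)
  ultimately show ?thesis by simp
qed

lemma open_hyp_ball:
  assumes "z \<in> unit_disk"
  shows "open (hyp_ball z s)"
proof -
  have "hyp_ball z s = Pair z -` {(z, w). z \<in> unit_disk \<and> w \<in> hyp_ball z s}"
    using assms by auto
  moreover have "open \<dots>"
    using open_hyp_ball_pairs by (rule open_vimage) (intro continuous_intros)
  ultimately show ?thesis by simp
qed

section \<open>Comparison with Euclidean disks\<close>

lemma hyp_ball_supset_ball:
  assumes "z \<in> unit_disk" "0 < s"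
  shows "ball z (tanh (s / 2) * (1 - norm z)) \<subseteq> hyp_ball z s"
proof
  fix w assume "w \<in> ball z (tanh (s / 2) * (1 - norm z))"
  then have d: "norm (z - w) < tanh (s / 2) * (1 - norm z)"
    by (simp add: dist_norm)
  have t: "0 < tanh (s / 2)" "tanh (s / 2) < 1" using assms(2) by (auto simp: tanh_real_lt_1)
  have nz: "norm z < 1" using assms by simp
  have d': "norm (z - w) < 1 - norm z"
    using d t nz by (smt (verit) mult_less_cancel_right1)
  have "norm w \<le> norm z + norm (z - w)"
    by (metis norm_minus_commute norm_triangle_sub)
  then have w: "w \<in> unit_disk" using d' by simp
  \<comment> \<open>Expanding around w = z gives |1 - cnj z w| \<ge> 1 - |z|^2 - |z| (1 - |z|) = 1 -
    |z|.\<close>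
  have "1 - cnj z * w = 1 - cnj z * z + cnj z * (z - w)" by (simp add: algebra_simps)
  then have "norm (1 - cnj z * w) \<ge> norm (1 - cnj z * z) - norm (cnj z * (z - w))"
    by (metis norm_diff_ineq)
  moreover have "norm (1 - cnj z * z) \<ge> 1 - norm z * norm z"
    by (metis norm_one norm_triangle_ineq2 norm_mult complex_mod_cnj)
  moreover have "norm (cnj z * (z - w)) \<le> norm z * (1 - norm z)"
    using d' by (simp add: norm_mult mult_left_mono)
  ultimately have "norm (1 - cnj z * w) \<ge> 1 - norm z"
    by (simp add: algebra_simps)
  then have "tanh (s / 2) * (1 - norm z) \<le> tanh (s / 2) * norm (1 - cnj z * w)"
    using t by simp
  with d w show "w \<in> hyp_ball z s"
    unfolding mem_hyp_ball_iff[OF assms(1)] by linarith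
qed

text \<open>Here |1 - cnj z w| \<le> 2 (1 - |z|) + |z - w|. As \<open>T\<close> is below 1, the term
  T |z - w| is absorbed on the left.\<close>

lemma hyp_ball_norm_bound:
  assumes "z \<in> unit_disk" "w \<in> hyp_ball z s" "0 < s"
  defines "T \<equiv> tanh (s / 2)"
  shows "norm (z - w) \<le> 2 * T / (1 - T) * (1 - norm z)"
proof -
  have T: "0 < T" "T < 1" using assms(3) by (auto simp: T_def tanh_real_lt_1)
  have nz: "norm z < 1" using assms by simp
  have "1 - cnj z * w = 1 - cnj z * z + cnj z * (z - w)" by (simp add: algebra_simps)
  then have "norm (1 - cnj z * w) \<le> norm (1 - cnj z * z) + norm (cnj z * (z - w))"
    by (metis norm_triangle_ineq)
  moreover have "norm (1 - cnj z * z) = 1 - norm z * norm z"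
  proof -
    have "1 - cnj z * z = of_real (1 - norm z * norm z)"
      by (simp add: complex_norm_square[symmetric] power2_eq_square mult.commute[of "cnj z"])
    then show ?thesis
      using nz by (metis abs_of_nonneg diff_ge_0_iff_ge less_imp_le mult_le_one norm_ge_zero norm_of_real)
  qed
  moreover have "norm (cnj z * (z - w)) \<le> norm (z - w)"
    using nz by (simp add: norm_mult mult_left_le_one_le)
  moreover have "1 - norm z * norm z \<le> 2 * (1 - norm z)"
    using nz sum_squares_ge_zero[of "1 - norm z" 0] by (simp add: algebra_simps)
  ultimately have "norm (1 - cnj z * w) \<le> 2 * (1 - norm z) + norm (z - w)"
    by linarith
  then have "T * norm (1 - cnj z * w) \<le> T * (2 * (1 - norm z) + norm (z - w))"
    using T by simp
  moreover have "norm (z - w) < T * norm (1 - cnj z * w)"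
    using assms(2) unfolding mem_hyp_ball_iff[OF assms(1)] T_def by simp
  ultimately have "norm (z - w) * (1 - T) \<le> 2 * T * (1 - norm z)"
    by (simp add: algebra_simps)
  then show ?thesis using T by (simp add: field_simps)
qed

lemma hyp_ball_euclidean_bound:
  assumes "0 < s"
  obtains K where "0 < K"
    "\<And>z w. z \<in> unit_disk \<Longrightarrow> w \<in> hyp_ball z s \<Longrightarrow> norm (z - w) \<le> K * (1 - norm z)"
    "\<And>z w. z \<in> unit_disk \<Longrightarrow> w \<in> hyp_ball z s \<Longrightarrow> 1 - norm z \<le> (1 + K) * (1 - norm w)"
proof
  define K where "K = 2 * tanh (s / 2) / (1 - tanh (s / 2))"
  show "0 < K" using assms by (simp add: K_def tanh_real_lt_1)
  show b: "norm (z - w) \<le> K * (1 - norm z)" if "z \<in> unit_disk" "w \<in> hyp_ball z s" for z w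
    unfolding K_def using hyp_ball_norm_bound[OF that assms] .
  show "1 - norm z \<le> (1 + K) * (1 - norm w)" if zw: "z \<in> unit_disk" "w \<in> hyp_ball z s" for z w
  proof -
    have "w \<in> unit_disk" using zw by (simp add: hyp_ball_def)
    \<comment> \<open>By symmetry of the distance, the first bound also holds with \<open>w\<close>
      as center; the triangle inequality then controls 1 - |z| by 1 - |w|.\<close>
    then have "norm (w - z) \<le> K * (1 - norm w)"
      using b hyp_ball_sym zw by blast
    moreover have "norm w \<le> norm z + norm (w - z)"
      by (simp add: norm_triangle_sub)
    ultimately show ?thesis by (simp add: algebra_simps)
  qed
qed

text \<open>Passes from the radius \<open>r\<close> of the oscillation condition to an arbitrary
  radius \<open>R\<close>. The number \<open>N\<close> of steps from \<open>z\<close> to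
  \<open>w\<close> depends only on \<open>r\<close> and \<open>R\<close>, so \<Lambda>^N is a
  uniform constant.\<close>

lemma BHO_comparable:
  assumes r: "0 < r" and pos: "\<And>z. z \<in> unit_disk \<Longrightarrow> 0 < \<omega> z" and bho: "\<omega> \<in> BHO r" and R: "0 < R"
  obtains L where "0 < L" "\<And>z w. z \<in> unit_disk \<Longrightarrow> w \<in> hyp_ball z R \<Longrightarrow> \<omega> z \<le> L * \<omega> w"
proof -
  obtain \<Lambda> where \<Lambda>: "\<And>z w w'. z \<in> unit_disk \<Longrightarrow> w \<in> hyp_ball z r \<Longrightarrow> w' \<in> hyp_ball z r \<Longrightarrow> \<omega> w / \<omega> w' \<le> \<Lambda>"
    using bho unfolding BHO_def mem_Collect_eq by blast
  \<comment> \<open>The ratio of \<open>\<omega> 0\<close> to itself is one of the bounded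
    quotients.\<close>
  have "1 \<le> \<Lambda>"
    using \<Lambda>[of 0 0 0] center_in_hyp_ball[of 0 r] r pos[of 0] by simp
  obtain K where K: "0 < K"
    "\<And>z w. z \<in> unit_disk \<Longrightarrow> w \<in> hyp_ball z R \<Longrightarrow> norm (z - w) \<le> K * (1 - norm z)"
    "\<And>z w. z \<in> unit_disk \<Longrightarrow> w \<in> hyp_ball z R \<Longrightarrow> 1 - norm z \<le> (1 + K) * (1 - norm w)"
    using hyp_ball_euclidean_bound[OF R] by blast
  define t where "t = tanh (r / 2)"
  have t: "0 < t" using r by (simp add: t_def)
  \<comment> \<open>Each of \<open>N\<close> equal steps has length at most K (1 - |z|) / N = K (1 +
    K) \<delta> / N, with \<delta> defined below; this choice of \<open>N\<close> makes it less than
    t \<delta>.\<close>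
  obtain N :: nat where N: "K * (1 + K) / t < real N" using reals_Archimedean2 by blast
  then have Npos: "0 < real N" using K(1) t by (smt (verit) divide_pos_pos mult_pos_pos)
  show thesis
  proof
    show "0 < \<Lambda> ^ N" using \<open>1 \<le> \<Lambda>\<close> by simp
    fix z w assume zw: "z \<in> unit_disk" "w \<in> hyp_ball z R"
    define u where "u i = z + of_real (real i / real N) * (w - z)" for i
    \<comment> \<open>A lower bound for the Euclidean distance of both endpoints to the unit circle.
      By convexity of \<open>cball 0 (1 - \<delta>)\<close> it holds along the whole segment, so the
      disk of radius t \<delta> about each \<open>u i\<close> lies in
      \<open>hyp_ball (u i) r\<close>.\<close>
    define \<delta> where "\<delta> = (1 - norm z) / (1 + K)"
    have dpos: "0 < \<delta>" using zw K(1) by (simp add: \<delta>_def)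
    have \<delta>: "\<delta> \<le> 1 - norm z" "\<delta> \<le> 1 - norm w"
      using K(1) K(3)[OF zw] zw by (simp_all add: \<delta>_def field_simps)
    have u: "norm (u i) \<le> 1 - \<delta>" if "i \<le> N" for i
    proof -
      have l: "0 \<le> real i / real N" "real i / real N \<le> 1" using that Npos by (auto simp: field_simps)
      have "z \<in> cball 0 (1 - \<delta>)" "w \<in> cball 0 (1 - \<delta>)" using \<delta> by auto
      then have "(1 - real i / real N) *\<^sub>R z + (real i / real N) *\<^sub>R w \<in> cball 0 (1 - \<delta>)"
        using l by (intro convexD[OF convex_cball]) auto
      also have "(1 - real i / real N) *\<^sub>R z + (real i / real N) *\<^sub>R w = u i"
        by (simp add: u_def scaleR_conv_of_real ring_distribs diff_divide_distrib)
      finally show ?thesis by simp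
    qed
    have step: "\<omega> (u i) \<le> \<Lambda> * \<omega> (u (Suc i))" if "Suc i \<le> N" for i
    proof -
      have ud: "u i \<in> unit_disk" "u (Suc i) \<in> unit_disk"
        using u[of i] u[of "Suc i"] that dpos by auto
      have "u i - u (Suc i) = of_real (1 / real N) * (z - w)"
        using Npos by (simp add: u_def field_simps)
      then have "norm (u i - u (Suc i)) = norm (z - w) / real N"
        by (simp add: norm_mult norm_divide)
      also have "\<dots> \<le> K * (1 - norm z) / real N"
        using K(2)[OF zw] by (simp add: divide_right_mono)
      also have "\<dots> = K * (1 + K) * \<delta> / real N"
        using K(1) by (simp add: \<delta>_def)
      also have "\<dots> < t * \<delta>"
      proof -
        have "K * (1 + K) < t * real N" using N t by (simp add: field_simps)
        then have "K * (1 + K) * \<delta> < t * real N * \<delta>" using dpos by (rule mult_strict_right_mono)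
        then show ?thesis using Npos by (simp add: field_simps)
      qed
      also have "\<dots> \<le> t * (1 - norm (u i))"
        using u[of i] that t by simp
      finally have "u (Suc i) \<in> hyp_ball (u i) r"
        using hyp_ball_supset_ball[OF ud(1) r] by (auto simp: t_def dist_norm)
      then have "\<omega> (u i) / \<omega> (u (Suc i)) \<le> \<Lambda>"
        using \<Lambda> center_in_hyp_ball ud(1) r by blast
      with pos[OF ud(2)] show ?thesis
        by (simp add: pos_divide_le_eq)
    qed
    have "\<omega> z \<le> \<Lambda> ^ i * \<omega> (u i)" if "i \<le> N" for i
      using that
    proof (induction i)
      case 0
      then show ?case by (simp add: u_def)
    next
      case (Suc i)
      then have "\<omega> z \<le> \<Lambda> ^ i * \<omega> (u i)" by simp
      also have "\<dots> \<le> \<Lambda> ^ i * (\<Lambda> * \<omega> (u (Suc i)))"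
        using step[OF Suc.prems] \<open>1 \<le> \<Lambda>\<close> by (intro mult_left_mono) auto
      finally show ?case by (simp add: mult_ac)
    qed
    moreover have "u N = w" using Npos by (simp add: u_def)
    ultimately show "\<omega> z \<le> \<Lambda> ^ N * \<omega> w" by (metis order_refl)
  qed
qed

section \<open>Powers and averages in the extended nonnegative reals\<close>

lemma ennreal_inverse_antimono: "x \<le> y \<Longrightarrow> inverse y \<le> inverse (x :: ennreal)"
proof (cases "x = 0 \<or> y = top")
  case False
  assume "x \<le> y"
  with False obtain a b where "x = ennreal a" "y = ennreal b" "0 < a" "a \<le> b"
    by (cases x; cases y) (auto simp: top_unique less_le)
  then show ?thesis by (simp add: inverse_ennreal ennreal_leI)
qed auto

lemma ennreal_powr_ennreal: "0 \<le> x \<Longrightarrow> ennreal_powr (ennreal x) p = ennreal (x powr p)"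
  by (simp add: ennreal_powr_def)

lemma ennreal_powr_mono:
  assumes "0 \<le> p" "x \<le> y"
  shows "ennreal_powr x p \<le> ennreal_powr y p"
  using assms
  by (auto simp: ennreal_powr_def top_unique less_top intro!: ennreal_leI powr_mono2 enn2real_mono)

text \<open>No sign condition on the exponents: \<open>top\<close> is sent to \<open>top\<close> by
  every power.\<close>

lemma ennreal_powr_powr: "ennreal_powr (ennreal_powr x p) q = ennreal_powr x (p * q)"
  by (simp add: ennreal_powr_def powr_powr)

lemma ennreal_powr_one [simp]: "ennreal_powr x 1 = x"
  by (cases x) (simp_all add: ennreal_powr_def)

text \<open>With \<open>c\<close> strictly positive, both sides are \<open>top\<close> at x = top;
  for c = 0 the product 0 * top would be 0.\<close>

lemma ennreal_powr_cmult:
  assumes "0 < c"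
  shows "ennreal_powr (ennreal c * x) p = ennreal (c powr p) * ennreal_powr x p"
  using assms
  by (cases x) (auto simp: ennreal_powr_def ennreal_mult_top ennreal_mult_eq_top_iff enn2real_mult powr_mult
      simp flip: ennreal_mult')

lemma measurable_ennreal_powr [measurable]: "(\<lambda>x. ennreal_powr x p) \<in> borel_measurable borel"
  unfolding ennreal_powr_def by measurable

text \<open>Jensen's inequality for t^p, obtained by integrating Young's inequality for f(x) b over
  \<open>A\<close> and then choosing the constant \<open>b\<close> optimally.\<close>

lemma powr_average_le_average_powr:
  fixes f :: "'a \<Rightarrow> real"
  assumes p: "1 \<le> p" and A [measurable]: "A \<in> sets M" and m: "0 < emeasure M A" "emeasure M A < top"
    and f [measurable]: "f \<in> borel_measurable M" and nonneg: "\<And>x. 0 \<le> f x"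
  shows "ennreal_powr ((\<integral>\<^sup>+x\<in>A. ennreal (f x) \<partial>M) / emeasure M A) p
    \<le> (\<integral>\<^sup>+x\<in>A. ennreal (f x powr p) \<partial>M) / emeasure M A"
proof (cases "p = 1 \<or> (\<integral>\<^sup>+x\<in>A. ennreal (f x powr p) \<partial>M) = top")
  \<comment> \<open>For p = 1 there is no finite conjugate exponent, but both sides agree; if the
    integral of the p-th power is infinite, so is the right-hand side, because \<open>A\<close> has
    finite measure.\<close>
  case True
  then show ?thesis
  proof
    assume "p = 1"
    then show ?thesis using nonneg by simp
  next
    assume "(\<integral>\<^sup>+x\<in>A. ennreal (f x powr p) \<partial>M) = top"
    then show ?thesis using m by (simp add: ennreal_top_divide less_top)
  qed
next
  case False
  define q where "q = p / (p - 1)"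
  have p1: "1 < p" using p False by simp
  then have q: "1 < q" "1 / p + 1 / q = 1" by (simp_all add: q_def field_simps)
  obtain c where c: "0 \<le> c" "(\<integral>\<^sup>+x\<in>A. ennreal (f x powr p) \<partial>M) = ennreal c"
    using False by (auto elim: ennreal_cases)
  obtain \<mu> where \<mu>: "0 < \<mu>" "emeasure M A = ennreal \<mu>"
    using m by (cases "emeasure M A") auto
  have young: "ennreal b * (\<integral>\<^sup>+x\<in>A. ennreal (f x) \<partial>M) \<le> ennreal (c / p + b powr q / q * \<mu>)"
    if b: "0 \<le> b" for b
  proof -
    have "ennreal b * (\<integral>\<^sup>+x\<in>A. ennreal (f x) \<partial>M) = (\<integral>\<^sup>+x. ennreal b * (ennreal (f x) * indicator A x) \<partial>M)"
      by (rule nn_integral_cmult[symmetric]) measurable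
    also have "\<dots> \<le> (\<integral>\<^sup>+x. ennreal (1 / p) * (ennreal (f x powr p) * indicator A x)
                            + ennreal (b powr q / q) * indicator A x \<partial>M)"
    proof (rule nn_integral_mono)
      fix x
      have "b * f x \<le> 1 / p * f x powr p + b powr q / q"
        using Youngs_inequality[OF p1 q nonneg b, of x] by (simp add: mult.commute)
      then have "ennreal (b * f x) \<le> ennreal (1 / p * f x powr p + b powr q / q)"
        by (rule ennreal_leI)
      then show "ennreal b * (ennreal (f x) * indicator A x) \<le>
          ennreal (1 / p) * (ennreal (f x powr p) * indicator A x) + ennreal (b powr q / q) * indicator A x"
        using b p1 q nonneg by (simp add: indicator_def flip: ennreal_mult')
    qed
    also have "\<dots> = ennreal (1 / p) * ennreal c + ennreal (b powr q / q) * ennreal \<mu>"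
      by (subst nn_integral_add, measurable, subst nn_integral_cmult, measurable)
         (simp add: nn_integral_cmult_indicator c(2)[symmetric] \<mu>(2)[symmetric])
    also have "\<dots> = ennreal (c / p + b powr q / q * \<mu>)"
      using c(1) \<mu>(1) p1 q by (simp flip: ennreal_mult')
    finally show ?thesis .
  qed
  \<comment> \<open>Young's inequality with b = 1 already shows that the average is finite, so the
    rest is real arithmetic.\<close>
  have "(\<integral>\<^sup>+x\<in>A. ennreal (f x) \<partial>M) < top"
    using young[of 1] by (simp add: order_le_less_trans del: less_top)
  then obtain a where a: "0 \<le> a" "(\<integral>\<^sup>+x\<in>A. ennreal (f x) \<partial>M) = ennreal a"
    by (auto elim: ennreal_cases)
  define t where "t = a / \<mu>"
  have t: "0 \<le> t" using a \<mu> by (simp add: t_def)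
  \<comment> \<open>With \<open>t\<close> the average, b = t^(p - 1) is the equality case of Young's
    inequality for the constant function \<open>t\<close>. Since (p - 1) q = p, only powers t^p
    remain.\<close>
  have "ennreal (t powr (p - 1) * a) \<le> ennreal (c / p + (t powr (p - 1)) powr q / q * \<mu>)"
    using young[of "t powr (p - 1)"] a by (simp add: ennreal_mult')
  then have "t powr (p - 1) * a \<le> c / p + (t powr (p - 1)) powr q / q * \<mu>"
    using c(1) \<mu>(1) p1 q by (subst (asm) ennreal_le_iff) auto
  moreover have "(t powr (p - 1)) powr q = t powr p"
    using p1 by (simp add: powr_powr q_def)
  moreover have "t powr (p - 1) * a = \<mu> * t powr p"
  proof -
    have "t powr p = t powr (p - 1) * t" using powr_add[of t "p - 1" 1] t by simp
    then show ?thesis using \<mu>(1) by (simp add: t_def)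
  qed
  ultimately have "\<mu> * t powr p \<le> c / p + t powr p / q * \<mu>" by simp
  moreover have "t powr p / q = t powr p - t powr p / p"
    using p1 by (simp add: q_def field_simps)
  ultimately have "\<mu> * t powr p / p \<le> c / p" by (simp add: algebra_simps)
  then have "t powr p \<le> c / \<mu>" using p1 \<mu>(1) by (simp add: field_simps)
  then show ?thesis
    using a c \<mu> t by (simp add: divide_ennreal ennreal_powr_ennreal t_def[symmetric] ennreal_leI)
qed

section \<open>Averages over hyperbolic balls\<close>

text \<open>Only the sigma-algebra of \<open>M\<close> enters, so this serves the weighted area and
  plain Lebesgue measure on the disk alike.\<close>

lemma hyp_ball_in_sets:
  assumes "sets M = sets (lebesgue_on unit_disk)" "z \<in> unit_disk"
  shows "hyp_ball z s \<in> sets M"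
proof -
  have "hyp_ball z s \<in> sets lebesgue"
    using open_hyp_ball[OF assms(2)] by simp
  then show ?thesis
    using hyp_ball_subset_disk by (simp add: assms(1) sets_restrict_space_iff)
qed

text \<open>The strict inequality defining the ball leaves room for a smaller radius. The radii on
  the right may be negative for small \<open>n\<close>, which does no harm.\<close>

lemma hyp_ball_Union:
  "hyp_ball z s = (\<Union>n. hyp_ball z (s - 1 / real (Suc n)))"
proof
  show "hyp_ball z s \<subseteq> (\<Union>n. hyp_ball z (s - 1 / real (Suc n)))"
  proof
    fix w assume w: "w \<in> hyp_ball z s"
    then have "0 < s - hyp_dist z w" by (simp add: hyp_ball_def)
    then obtain n where "inverse (real (Suc n)) < s - hyp_dist z w"
      using reals_Archimedean by blast
    then show "w \<in> (\<Union>n. hyp_ball z (s - 1 / real (Suc n)))"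
      using w by (intro UN_I[of n]) (auto simp: hyp_ball_def inverse_eq_divide)
  qed
qed (use hyp_ball_mono[of "s - 1 / real (Suc _)" s z] in auto)

text \<open>Continuity from below of the measure with density \<open>f\<close> along the increasing
  union of balls.\<close>

lemma nn_integral_hyp_ball_SUP:
  assumes M: "sets M = sets (lebesgue_on unit_disk)" and z: "z \<in> unit_disk"
    and f: "f \<in> borel_measurable M"
  shows "(\<integral>\<^sup>+\<zeta>\<in>hyp_ball z s. f \<zeta> \<partial>M) = (SUP n. \<integral>\<^sup>+\<zeta>\<in>hyp_ball z (s - 1 / real (Suc n)). f \<zeta> \<partial>M)"
proof -
  let ?B = "\<lambda>n. hyp_ball z (s - 1 / real (Suc n))"
  have "(SUP n. emeasure (density M f) (?B n)) = emeasure (density M f) (\<Union>n. ?B n)"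
    using hyp_ball_in_sets[OF M z]
    by (intro SUP_emeasure_incseq image_subsetI incseq_SucI hyp_ball_mono) (auto simp: frac_le)
  then show ?thesis
    using hyp_ball_in_sets[OF M z] f
    by (simp only: hyp_ball_Union[symmetric] emeasure_density[OF f hyp_ball_in_sets[OF M z]])
qed

text \<open>Averages over open balls are left lower semicontinuous in the radius, so countably many
  radii suffice.\<close>

lemma trunc_maximal_eq_SUP_Rats:
  assumes M: "sets M = sets (lebesgue_on unit_disk)" and z: "z \<in> unit_disk"
    and g: "g \<in> borel_measurable M"
  shows "trunc_maximal M r1 r0 g z = (SUP q\<in>\<rat> \<inter> {r1<..r0}.
      (\<integral>\<^sup>+\<zeta>\<in>hyp_ball z q. ennreal (norm (g \<zeta>)) \<partial>M) / emeasure M (hyp_ball z q))"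
    (is "_ = ?S")
  unfolding trunc_maximal_def
proof (rule antisym)
  let ?I = "\<lambda>s. \<integral>\<^sup>+\<zeta>\<in>hyp_ball z s. ennreal (norm (g \<zeta>)) \<partial>M"
  show "(SUP s\<in>{r1<..r0}. ?I s / emeasure M (hyp_ball z s)) \<le> ?S"
  proof (rule SUP_least)
    fix s assume s: "s \<in> {r1<..r0}"
    have "?I s / emeasure M (hyp_ball z s) =
        (SUP n. ?I (s - 1 / real (Suc n)) / emeasure M (hyp_ball z s))"
      using g by (subst nn_integral_hyp_ball_SUP[OF M z]) (auto simp: SUP_divide_ennreal)
    also have "\<dots> \<le> ?S"
    proof (rule SUP_least)
      fix n
      \<comment> \<open>A rational \<open>q\<close> in this gap gives a ball between the shrunken
        one and \<open>hyp_ball z s\<close>: passing to \<open>q\<close> increases the integral and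
        decreases the measure in the denominator. Staying above \<open>r1\<close> is possible
        because r1 < s is strict.\<close>
      have "max r1 (s - 1 / real (Suc n)) < s" using s by simp
      then obtain q where q: "q \<in> \<rat>" "max r1 (s - 1 / real (Suc n)) < q" "q < s"
        using Rats_dense_in_real by blast
      have "?I (s - 1 / real (Suc n)) \<le> ?I q"
        using q hyp_ball_mono[of "s - 1 / real (Suc n)" q z]
        by (intro nn_integral_mono mult_left_mono) (auto split: split_indicator)
      moreover have "emeasure M (hyp_ball z q) \<le> emeasure M (hyp_ball z s)"
        using q by (intro emeasure_mono hyp_ball_mono hyp_ball_in_sets[OF M z]) auto
      ultimately have "?I (s - 1 / real (Suc n)) / emeasure M (hyp_ball z s) \<le> ?I q / emeasure M (hyp_ball z q)"
        unfolding divide_ennreal_def by (intro mult_mono ennreal_inverse_antimono) auto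
      also have "\<dots> \<le> ?S" using q s by (intro SUP_upper) auto
      finally show "?I (s - 1 / real (Suc n)) / emeasure M (hyp_ball z s) \<le> ?S" .
    qed
    finally show "?I s / emeasure M (hyp_ball z s) \<le> ?S" .
  qed
qed (intro SUP_subset_mono, auto)

section \<open>Measurability of averages and of the maximal function\<close>

lemma measurable_indicator_hyp_ball_pairs:
  assumes M: "sets M = sets (lebesgue_on unit_disk)"
  shows "(\<lambda>x. indicator {(z, w). z \<in> unit_disk \<and> w \<in> hyp_ball z s} x :: ennreal) \<in> borel_measurable (M \<Otimes>\<^sub>M M)"
proof -
  have "(\<lambda>x. x) \<in> measurable (lebesgue_on unit_disk) (borel :: complex measure)"
    using id_borel_measurable_lebesgue by (intro measurable_restrict_space1) (simp add: id_def)
  then have id: "(\<lambda>x. x) \<in> measurable M (borel :: complex measure)"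
    using M by (simp cong: measurable_cong_sets)
  \<comment> \<open>The product of two Lebesgue sigma-algebras contains the Borel sets of the
    product space, in particular the open set of pairs.\<close>
  have "(\<lambda>x. (fst x, snd x)) \<in> measurable (M \<Otimes>\<^sub>M M) (borel \<Otimes>\<^sub>M borel)"
    using measurable_compose[OF measurable_fst id] measurable_compose[OF measurable_snd id]
    by (intro measurable_Pair)
  then have "(\<lambda>x. x) \<in> measurable (M \<Otimes>\<^sub>M M) (borel :: (complex \<times> complex) measure)"
    by (simp add: borel_prod)
  from measurable_compose[OF this borel_measurable_indicator[OF borel_open[OF open_hyp_ball_pairs]]]
  show ?thesis .
qed

lemma space_disk_measure:
  "sets M = sets (lebesgue_on unit_disk) \<Longrightarrow> space M = unit_disk"
  by (metis (no_types, lifting) space_lebesgue_on sets_eq_imp_space_eq)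

lemma measurable_nn_integral_hyp_ball:
  assumes M: "sets M = sets (lebesgue_on unit_disk)" and "sigma_finite_measure M"
    and f [measurable]: "f \<in> borel_measurable M"
  shows "(\<lambda>z. \<integral>\<^sup>+\<zeta>\<in>hyp_ball z s. f \<zeta> \<partial>M) \<in> borel_measurable M"
proof -
  interpret sigma_finite_measure M by fact
  note [measurable] = measurable_indicator_hyp_ball_pairs[OF M]
  \<comment> \<open>The ball depending on \<open>z\<close> is replaced by a fixed set of pairs, so
    that the measurability half of Tonelli's theorem applies.\<close>
  have "(\<lambda>z. \<integral>\<^sup>+\<zeta>. f \<zeta> * indicator {(z, w). z \<in> unit_disk \<and> w \<in> hyp_ball z s} (z, \<zeta>) \<partial>M) \<in> borel_measurable M"
    by measurable
  moreover have "(\<integral>\<^sup>+\<zeta>\<in>hyp_ball z s. f \<zeta> \<partial>M) =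
      (\<integral>\<^sup>+\<zeta>. f \<zeta> * indicator {(z, w). z \<in> unit_disk \<and> w \<in> hyp_ball z s} (z, \<zeta>) \<partial>M)"
    if "z \<in> space M" for z
    using that by (intro nn_integral_cong) (auto simp: space_disk_measure[OF M] split: split_indicator)
  ultimately show ?thesis by (subst measurable_cong) auto
qed

lemma measurable_emeasure_hyp_ball:
  assumes M: "sets M = sets (lebesgue_on unit_disk)" and "sigma_finite_measure M"
  shows "(\<lambda>z. emeasure M (hyp_ball z s)) \<in> borel_measurable M"
proof -
  have "(\<lambda>z. \<integral>\<^sup>+\<zeta>\<in>hyp_ball z s. 1 \<partial>M) \<in> borel_measurable M"
    by (intro measurable_nn_integral_hyp_ball assms) simp
  moreover have "emeasure M (hyp_ball z s) = (\<integral>\<^sup>+\<zeta>\<in>hyp_ball z s. 1 \<partial>M)" if "z \<in> space M" for z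
    using that hyp_ball_in_sets[OF M] by (simp add: space_disk_measure[OF M])
  ultimately show ?thesis by (subst measurable_cong) auto
qed

lemma measurable_trunc_maximal:
  assumes M: "sets M = sets (lebesgue_on unit_disk)" and sf: "sigma_finite_measure M"
    and g: "g \<in> borel_measurable M"
  shows "trunc_maximal M r1 r0 g \<in> borel_measurable M"
proof -
  have "(\<lambda>z. SUP q\<in>\<rat> \<inter> {r1<..r0}.
      (\<integral>\<^sup>+\<zeta>\<in>hyp_ball z q. ennreal (norm (g \<zeta>)) \<partial>M) / emeasure M (hyp_ball z q)) \<in> borel_measurable M"
    using g by (intro borel_measurable_SUP borel_measurable_divide_ennreal measurable_nn_integral_hyp_ball[OF M sf]
        measurable_emeasure_hyp_ball[OF M sf] countable_Int1 countable_rat) auto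
  then show ?thesis
    using trunc_maximal_eq_SUP_Rats[OF M _ g]
    by (subst measurable_cong) (auto simp: space_disk_measure[OF M])
qed

text \<open>After exchanging the integrals, \<open>h w\<close> is multiplied by the integral of 1 /
  \<mu>(B(z, r0's smaller companion r1)) over z in B(w, r0). By \<open>doubling\<close> the
  integrand is at most C / \<mu>(B(w, r0)), so this factor is at most \<open>C\<close>.\<close>

lemma nn_integral_average_le:
  assumes M: "sets M = sets (lebesgue_on unit_disk)" and sf: "sigma_finite_measure M"
    and h [measurable]: "h \<in> borel_measurable M"
    and fin: "\<And>w. w \<in> unit_disk \<Longrightarrow> 0 < emeasure M (hyp_ball w r0) \<and> emeasure M (hyp_ball w r0) < top"
    and C: "0 < C" and doubling: "\<And>z w. w \<in> unit_disk \<Longrightarrow> z \<in> hyp_ball w r0 \<Longrightarrow>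
      emeasure M (hyp_ball w r0) \<le> ennreal C * emeasure M (hyp_ball z r1)"
  shows "(\<integral>\<^sup>+z. (\<integral>\<^sup>+\<zeta>\<in>hyp_ball z r0. h \<zeta> \<partial>M) / emeasure M (hyp_ball z r1) \<partial>M)
    \<le> ennreal C * (\<integral>\<^sup>+z. h z \<partial>M)"
proof -
  interpret sigma_finite_measure M by fact
  interpret P: pair_sigma_finite M M by standard
  note space = space_disk_measure[OF M]
  note sets = hyp_ball_in_sets[OF M]
  define A where "A = {(z, w). z \<in> unit_disk \<and> w \<in> hyp_ball z r0}"
  define v where "v z = inverse (emeasure M (hyp_ball z r1))" for z
  have v [measurable]: "v \<in> borel_measurable M"
    unfolding v_def using measurable_emeasure_hyp_ball[OF M sf] by measurable
  have A [measurable]: "(\<lambda>x. indicator A x :: ennreal) \<in> borel_measurable (M \<Otimes>\<^sub>M M)"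
    unfolding A_def by (rule measurable_indicator_hyp_ball_pairs[OF M])
  \<comment> \<open>Symmetry of the distance turns a ball around \<open>z\<close> into a ball around
    \<open>w\<close>, the domain of the inner integral after the exchange.\<close>
  have indA: "(indicator A (z, w) :: ennreal) = indicator (hyp_ball w r0) z"
    if "z \<in> unit_disk" "w \<in> unit_disk" for z w
    using hyp_ball_sym that by (auto simp: A_def split: split_indicator)
  have "(\<integral>\<^sup>+z. (\<integral>\<^sup>+\<zeta>\<in>hyp_ball z r0. h \<zeta> \<partial>M) / emeasure M (hyp_ball z r1) \<partial>M)
      = (\<integral>\<^sup>+z. (\<integral>\<^sup>+\<zeta>. v z * (h \<zeta> * indicator A (z, \<zeta>)) \<partial>M) \<partial>M)"
  proof (rule nn_integral_cong)
    fix z assume "z \<in> space M"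
    then have z: "z \<in> unit_disk" by (simp add: space)
    have [measurable]: "(\<lambda>\<zeta>. h \<zeta> * indicator (hyp_ball z r0) \<zeta>) \<in> borel_measurable M"
      using sets[OF z] by measurable
    have "(\<integral>\<^sup>+\<zeta>\<in>hyp_ball z r0. h \<zeta> \<partial>M) / emeasure M (hyp_ball z r1)
        = (\<integral>\<^sup>+\<zeta>. v z * (h \<zeta> * indicator (hyp_ball z r0) \<zeta>) \<partial>M)"
      by (subst nn_integral_cmult) (auto simp: v_def divide_ennreal_def mult.commute)
    also have "\<dots> = (\<integral>\<^sup>+\<zeta>. v z * (h \<zeta> * indicator A (z, \<zeta>)) \<partial>M)"
      using z by (intro nn_integral_cong) (auto simp: A_def split: split_indicator)
    finally show "(\<integral>\<^sup>+\<zeta>\<in>hyp_ball z r0. h \<zeta> \<partial>M) / emeasure M (hyp_ball z r1)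
        = (\<integral>\<^sup>+\<zeta>. v z * (h \<zeta> * indicator A (z, \<zeta>)) \<partial>M)" .
  qed
  also have "\<dots> = (\<integral>\<^sup>+\<zeta>. (\<integral>\<^sup>+z. v z * (h \<zeta> * indicator A (z, \<zeta>)) \<partial>M) \<partial>M)"
    by (rule P.Fubini'[symmetric]) measurable
  also have "\<dots> \<le> (\<integral>\<^sup>+\<zeta>. ennreal C * h \<zeta> \<partial>M)"
  proof (rule nn_integral_mono)
    fix w assume "w \<in> space M"
    then have w: "w \<in> unit_disk" by (simp add: space)
    let ?m = "emeasure M (hyp_ball w r0)"
    have le: "v z \<le> ennreal C * inverse ?m" if "z \<in> hyp_ball w r0" for z
    proof -
      have "inverse (ennreal C * emeasure M (hyp_ball z r1)) \<le> inverse ?m"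
        by (rule ennreal_inverse_antimono[OF doubling[OF w that]])
      then have "ennreal C * inverse (ennreal C * emeasure M (hyp_ball z r1)) \<le> ennreal C * inverse ?m"
        by (rule mult_left_mono) simp
      also have "ennreal C * inverse (ennreal C * emeasure M (hyp_ball z r1)) = v z"
      proof -
        have "ennreal C * inverse (ennreal C) = 1"
          using C by (simp add: inverse_ennreal flip: ennreal_mult')
        then show ?thesis
          using C by (simp add: v_def ennreal_inverse_mult' flip: mult.assoc)
      qed
      finally show ?thesis .
    qed
    have "(\<integral>\<^sup>+z. v z * (h w * indicator A (z, w)) \<partial>M)
        \<le> (\<integral>\<^sup>+z. (ennreal C * inverse ?m * h w) * indicator (hyp_ball w r0) z \<partial>M)"
    proof (rule nn_integral_mono)
      fix z assume "z \<in> space M"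
      then have "z \<in> unit_disk" by (simp add: space)
      then show "v z * (h w * indicator A (z, w)) \<le> (ennreal C * inverse ?m * h w) * indicator (hyp_ball w r0) z"
        using le[of z] by (simp add: indA[OF _ w] split: split_indicator) (blast intro: mult_right_mono zero_le)
    qed
    also have "\<dots> = ennreal C * h w * (inverse ?m * ?m)"
      using sets[OF w] by (subst nn_integral_cmult_indicator) (auto simp: mult_ac)
    \<comment> \<open>In \<open>ennreal\<close> this cancellation needs \<open>?m\<close> to be
      neither 0 nor \<open>top\<close>.\<close>
    also have "inverse ?m * ?m = 1"
      using fin[OF w] ennreal_divide_self[of ?m] by (auto simp: divide_ennreal_def mult.commute)
    finally show "(\<integral>\<^sup>+z. v z * (h w * indicator A (z, w)) \<partial>M) \<le> ennreal C * h w" by simp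
  qed
  also have "\<dots> = ennreal C * (\<integral>\<^sup>+z. h z \<partial>M)" by (rule nn_integral_cmult) fact
  finally show ?thesis .
qed

section \<open>Weighted area of hyperbolic balls\<close>

lemma sets_weighted_area: "sets (weighted_area \<omega>) = sets (lebesgue_on unit_disk)"
  by (simp add: weighted_area_def disk_area_def)

lemma measurable_disk_weight:
  "disk_weight \<omega> \<Longrightarrow> (\<lambda>z. ennreal (\<omega> z)) \<in> borel_measurable disk_area"
  by (auto simp: disk_weight_def disk_area_def cong: measurable_cong_sets)

text \<open>The disk has finite area and the real-valued density is nowhere infinite; the weighted
  area itself may well be infinite.\<close>

lemma sigma_finite_weighted_area:
  assumes "disk_weight \<omega>"
  shows "sigma_finite_measure (weighted_area \<omega>)"
proof -
  have "finite_measure disk_area"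
    by (rule finite_measureI)
      (simp add: disk_area_def space_scale_measure emeasure_restrict_space emeasure_ball ennreal_mult_eq_top_iff)
  then interpret finite_measure disk_area .
  show ?thesis
    unfolding weighted_area_def
    using sigma_finite_iff_density_finite[OF measurable_disk_weight[OF assms]] by simp
qed

lemma emeasure_disk_area:
  assumes "B \<subseteq> unit_disk"
  shows "emeasure disk_area B = ennreal (1 / pi) * emeasure lebesgue B"
  using assms by (simp add: disk_area_def emeasure_restrict_space)

text \<open>The normalisation 1 / pi cancels the pi in the area of a Euclidean disk.\<close>

lemma emeasure_disk_area_le:
  assumes "B \<subseteq> unit_disk" "B \<subseteq> cball z \<rho>" "0 \<le> \<rho>"
  shows "emeasure disk_area B \<le> ennreal (\<rho>\<^sup>2)"
proof -
  have "emeasure lebesgue B \<le> emeasure lebesgue (cball z \<rho>)"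
    using assms(2) by (intro emeasure_mono) auto
  also have "\<dots> = ennreal (pi * \<rho>\<^sup>2)"
    using assms(3) by (simp add: emeasure_cball unit_ball_vol_2)
  finally have "ennreal (1 / pi) * emeasure lebesgue B \<le> ennreal (1 / pi) * ennreal (pi * \<rho>\<^sup>2)"
    by (rule mult_left_mono) simp
  also have "\<dots> = ennreal (\<rho>\<^sup>2)" by (subst ennreal_mult'[symmetric]) auto
  finally show ?thesis by (simp add: emeasure_disk_area[OF assms(1)])
qed

lemma emeasure_disk_area_ge:
  assumes "B \<subseteq> unit_disk" "ball z \<rho> \<subseteq> B" "0 \<le> \<rho>" "B \<in> sets lebesgue"
  shows "ennreal (\<rho>\<^sup>2) \<le> emeasure disk_area B"
proof -
  have "ennreal (pi * \<rho>\<^sup>2) = emeasure lebesgue (ball z \<rho>)"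
    using assms(3) by (simp add: emeasure_ball unit_ball_vol_2)
  also have "\<dots> \<le> emeasure lebesgue B"
    using assms by (intro emeasure_mono) auto
  finally have "ennreal (1 / pi) * ennreal (pi * \<rho>\<^sup>2) \<le> ennreal (1 / pi) * emeasure lebesgue B"
    by (rule mult_left_mono) simp
  moreover have "ennreal (1 / pi) * ennreal (pi * \<rho>\<^sup>2) = ennreal (\<rho>\<^sup>2)"
    by (subst ennreal_mult'[symmetric]) auto
  ultimately show ?thesis by (simp add: emeasure_disk_area[OF assms(1)])
qed

lemma emeasure_weighted_area:
  assumes "disk_weight \<omega>" "B \<in> sets (lebesgue_on unit_disk)"
  shows "emeasure (weighted_area \<omega>) B = (\<integral>\<^sup>+z. ennreal (\<omega> z) * indicator B z \<partial>disk_area)"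
  unfolding weighted_area_def using assms measurable_disk_weight
  by (intro emeasure_density) (auto simp: disk_area_def)

lemma emeasure_hyp_ball_le:
  assumes r: "0 < r" and w: "disk_weight \<omega>" and bho: "\<omega> \<in> BHO r" and s: "0 < s"
  obtains a where "0 < a"
    "\<And>z. z \<in> unit_disk \<Longrightarrow> emeasure (weighted_area \<omega>) (hyp_ball z s) \<le> ennreal (a * \<omega> z * (1 - norm z)\<^sup>2)"
proof -
  have pos: "0 < \<omega> z" if "z \<in> unit_disk" for z using w that by (simp add: disk_weight_def)
  obtain K where K: "0 < K"
    "\<And>z w. z \<in> unit_disk \<Longrightarrow> w \<in> hyp_ball z s \<Longrightarrow> norm (z - w) \<le> K * (1 - norm z)"
    "\<And>z w. z \<in> unit_disk \<Longrightarrow> w \<in> hyp_ball z s \<Longrightarrow> 1 - norm z \<le> (1 + K) * (1 - norm w)"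
    using hyp_ball_euclidean_bound[OF s] by blast
  obtain L where L: "0 < L" "\<And>z w. z \<in> unit_disk \<Longrightarrow> w \<in> hyp_ball z s \<Longrightarrow> \<omega> z \<le> L * \<omega> w"
    using BHO_comparable[OF r pos bho s] by blast
  show thesis
  proof
    show "0 < L * K\<^sup>2" using K L by simp
    fix z assume z: "z \<in> unit_disk"
    let ?B = "hyp_ball z s"
    have B: "?B \<in> sets (lebesgue_on unit_disk)" using hyp_ball_in_sets[OF refl z] .
    have "emeasure (weighted_area \<omega>) ?B = (\<integral>\<^sup>+x. ennreal (\<omega> x) * indicator ?B x \<partial>disk_area)"
      by (rule emeasure_weighted_area[OF w B])
    also have "\<dots> \<le> (\<integral>\<^sup>+x. ennreal (L * \<omega> z) * indicator ?B x \<partial>disk_area)"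
      \<comment> \<open>An upper bound for \<open>\<omega> x\<close> requires comparability centered
        at \<open>x\<close>, hence the symmetry of the distance; the lower bound for the measure
        uses center \<open>z\<close> directly.\<close>
      using L(2) hyp_ball_sym[OF z] hyp_ball_subset_disk[of z s]
      by (intro nn_integral_mono) (auto simp: subset_iff intro!: ennreal_leI split: split_indicator)
    also have "\<dots> = ennreal (L * \<omega> z) * emeasure disk_area ?B"
      using B by (intro nn_integral_cmult_indicator) (simp add: disk_area_def)
    also have "\<dots> \<le> ennreal (L * \<omega> z) * ennreal ((K * (1 - norm z))\<^sup>2)"
      using K z hyp_ball_subset_disk
      by (intro mult_left_mono emeasure_disk_area_le[where z = z]) (auto simp: dist_norm)
    also have "\<dots> = ennreal (L * K\<^sup>2 * \<omega> z * (1 - norm z)\<^sup>2)"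
      using L(1) pos[OF z] by (subst ennreal_mult'[symmetric]) (auto simp: power_mult_distrib mult_ac)
    finally show "emeasure (weighted_area \<omega>) ?B \<le> ennreal (L * K\<^sup>2 * \<omega> z * (1 - norm z)\<^sup>2)" .
  qed
qed

lemma emeasure_hyp_ball_ge:
  assumes r: "0 < r" and w: "disk_weight \<omega>" and bho: "\<omega> \<in> BHO r" and s: "0 < s"
  obtains b where "0 < b"
    "\<And>z. z \<in> unit_disk \<Longrightarrow> ennreal (b * \<omega> z * (1 - norm z)\<^sup>2) \<le> emeasure (weighted_area \<omega>) (hyp_ball z s)"
proof -
  have pos: "0 < \<omega> z" if "z \<in> unit_disk" for z using w that by (simp add: disk_weight_def)
  define t where "t = tanh (s / 2)"
  have t: "0 < t" using s by (simp add: t_def)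
  obtain L where L: "0 < L" "\<And>z w. z \<in> unit_disk \<Longrightarrow> w \<in> hyp_ball z s \<Longrightarrow> \<omega> z \<le> L * \<omega> w"
    using BHO_comparable[OF r pos bho s] by blast
  show thesis
  proof
    show "0 < t\<^sup>2 / L" using t L by simp
    fix z assume z: "z \<in> unit_disk"
    let ?B = "hyp_ball z s"
    have B: "?B \<in> sets (lebesgue_on unit_disk)" using hyp_ball_in_sets[OF refl z] .
    have "ennreal (t\<^sup>2 / L * \<omega> z * (1 - norm z)\<^sup>2) = ennreal (\<omega> z / L) * ennreal ((t * (1 - norm z))\<^sup>2)"
      using L(1) pos[OF z] by (subst ennreal_mult'[symmetric]) (auto simp: power_mult_distrib mult_ac)
    also have "\<dots> \<le> ennreal (\<omega> z / L) * emeasure disk_area ?B"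
      using t z hyp_ball_subset_disk hyp_ball_supset_ball[OF z s] open_hyp_ball[OF z]
      by (intro mult_left_mono emeasure_disk_area_ge[where z = z]) (auto simp: t_def)
    also have "\<dots> = (\<integral>\<^sup>+x. ennreal (\<omega> z / L) * indicator ?B x \<partial>disk_area)"
      using B by (intro nn_integral_cmult_indicator[symmetric]) (simp add: disk_area_def)
    also have "\<dots> \<le> (\<integral>\<^sup>+x. ennreal (\<omega> x) * indicator ?B x \<partial>disk_area)"
      using L(1) L(2)[OF z]
      by (intro nn_integral_mono) (auto simp: pos_divide_le_eq mult.commute intro!: ennreal_leI split: split_indicator)
    also have "\<dots> = emeasure (weighted_area \<omega>) ?B"
      by (rule emeasure_weighted_area[OF w B, symmetric])
    finally show "ennreal (t\<^sup>2 / L * \<omega> z * (1 - norm z)\<^sup>2) \<le> emeasure (weighted_area \<omega>) ?B" .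
  qed
qed

lemma emeasure_hyp_ball_pos_finite:
  assumes "0 < r" "disk_weight \<omega>" "\<omega> \<in> BHO r" "0 < s" "z \<in> unit_disk"
  shows "0 < emeasure (weighted_area \<omega>) (hyp_ball z s) \<and> emeasure (weighted_area \<omega>) (hyp_ball z s) < top"
proof -
  obtain a where "emeasure (weighted_area \<omega>) (hyp_ball z s) \<le> ennreal (a * \<omega> z * (1 - norm z)\<^sup>2)"
    using emeasure_hyp_ball_le[OF assms(1-4)] assms(5) by blast
  then have "emeasure (weighted_area \<omega>) (hyp_ball z s) < top"
    by (rule order_le_less_trans) simp
  moreover obtain b where "0 < b"
    "ennreal (b * \<omega> z * (1 - norm z)\<^sup>2) \<le> emeasure (weighted_area \<omega>) (hyp_ball z s)"
    using emeasure_hyp_ball_ge[OF assms(1-4)] assms(5) by blast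
  moreover have "0 < \<omega> z" "0 < 1 - norm z" using assms by (auto simp: disk_weight_def)
  ultimately show ?thesis
    by (metis ennreal_less_zero_iff less_le_trans mult_pos_pos zero_less_power)
qed

text \<open>Both measures are compared with \<omega> (1 - |.|)^2 at their own centers, and these
  quantities are comparable at bounded hyperbolic distance. The radii \<open>s\<close> and
  \<open>t\<close> are unrelated.\<close>

lemma emeasure_hyp_ball_doubling:
  assumes r: "0 < r" and w: "disk_weight \<omega>" and bho: "\<omega> \<in> BHO r" and s: "0 < s" and t: "0 < t"
  obtains C where "0 < C"
    "\<And>w z. w \<in> unit_disk \<Longrightarrow> z \<in> hyp_ball w s \<Longrightarrow>
      emeasure (weighted_area \<omega>) (hyp_ball w s) \<le> ennreal C * emeasure (weighted_area \<omega>) (hyp_ball z t)"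
proof -
  have pos: "0 < \<omega> z" if "z \<in> unit_disk" for z using w that by (simp add: disk_weight_def)
  obtain K where K: "0 < K"
    "\<And>z w. z \<in> unit_disk \<Longrightarrow> w \<in> hyp_ball z s \<Longrightarrow> norm (z - w) \<le> K * (1 - norm z)"
    "\<And>z w. z \<in> unit_disk \<Longrightarrow> w \<in> hyp_ball z s \<Longrightarrow> 1 - norm z \<le> (1 + K) * (1 - norm w)"
    using hyp_ball_euclidean_bound[OF s] by blast
  obtain L where L: "0 < L" "\<And>z w. z \<in> unit_disk \<Longrightarrow> w \<in> hyp_ball z s \<Longrightarrow> \<omega> z \<le> L * \<omega> w"
    using BHO_comparable[OF r pos bho s] by blast
  obtain a where a: "0 < a"
    "\<And>z. z \<in> unit_disk \<Longrightarrow> emeasure (weighted_area \<omega>) (hyp_ball z s) \<le> ennreal (a * \<omega> z * (1 - norm z)\<^sup>2)"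
    using emeasure_hyp_ball_le[OF r w bho s] by blast
  obtain b where b: "0 < b"
    "\<And>z. z \<in> unit_disk \<Longrightarrow> ennreal (b * \<omega> z * (1 - norm z)\<^sup>2) \<le> emeasure (weighted_area \<omega>) (hyp_ball z t)"
    using emeasure_hyp_ball_ge[OF r w bho t] by blast
  show thesis
  proof
    \<comment> \<open>Here \<open>a\<close> and \<open>b\<close> come from the upper bound at radius
      \<open>s\<close> and the lower bound at radius \<open>t\<close>; \<open>L\<close> and (1 +
      K)^2 pay for moving the center from \<open>w\<close> to \<open>z\<close>.\<close>
    define C where "C = a * L * (1 + K)\<^sup>2 / b"
    show "0 < C" using a b K L by (simp add: C_def)
    fix w z assume w: "w \<in> unit_disk" and z: "z \<in> hyp_ball w s"
    then have z': "z \<in> unit_disk" by (simp add: hyp_ball_def)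
    have "\<omega> w * (1 - norm w)\<^sup>2 \<le> (L * \<omega> z) * ((1 + K) * (1 - norm z))\<^sup>2"
      using L K(3)[OF w z] L(2)[OF w z] w pos[OF z'] by (intro mult_mono power_mono) auto
    then have "a * (\<omega> w * (1 - norm w)\<^sup>2) \<le> a * ((L * \<omega> z) * ((1 + K) * (1 - norm z))\<^sup>2)"
      using a(1) by simp
    also have "\<dots> = C * (b * \<omega> z * (1 - norm z)\<^sup>2)"
      using b(1) by (simp add: C_def power_mult_distrib)
    finally have "ennreal (a * \<omega> w * (1 - norm w)\<^sup>2) \<le> ennreal (C * (b * \<omega> z * (1 - norm z)\<^sup>2))"
      by (intro ennreal_leI) (simp add: mult.assoc)
    also have "\<dots> = ennreal C * ennreal (b * \<omega> z * (1 - norm z)\<^sup>2)"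
      using \<open>0 < C\<close> by (simp add: ennreal_mult')
    also have "\<dots> \<le> ennreal C * emeasure (weighted_area \<omega>) (hyp_ball z t)"
      by (intro mult_left_mono b(2) z') simp
    finally show "emeasure (weighted_area \<omega>) (hyp_ball w s) \<le> ennreal C * emeasure (weighted_area \<omega>) (hyp_ball z t)"
      using a(2)[OF w] by (rule order_trans[rotated])
  qed
qed

section \<open>Bounds for the maximal operator\<close>

text \<open>After Jensen, enlarging the domain of integration to radius \<open>r0\<close> and
  shrinking the ball in the denominator to radius \<open>r1\<close> gives a bound independent of
  \<open>s\<close>.\<close>

lemma trunc_maximal_powr_le:
  assumes M: "sets M = sets (lebesgue_on unit_disk)" and z: "z \<in> unit_disk" and p: "1 \<le> p" and r1: "0 < r1"
    and fin: "\<And>s. 0 < s \<Longrightarrow> 0 < emeasure M (hyp_ball z s) \<and> emeasure M (hyp_ball z s) < top"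
    and g [measurable]: "g \<in> borel_measurable M"
  shows "ennreal_powr (trunc_maximal M r1 r0 g z) p
    \<le> (\<integral>\<^sup>+\<zeta>\<in>hyp_ball z r0. ennreal (norm (g \<zeta>) powr p) \<partial>M) / emeasure M (hyp_ball z r1)"
    (is "_ \<le> ?U")
proof -
  \<comment> \<open>Bounding the averages by a p-th root first avoids exchanging the supremum with a
    power.\<close>
  have "trunc_maximal M r1 r0 g z \<le> ennreal_powr ?U (1 / p)"
    unfolding trunc_maximal_def
  proof (rule SUP_least)
    fix s assume s: "s \<in> {r1<..r0}"
    let ?X = "(\<integral>\<^sup>+\<zeta>\<in>hyp_ball z s. ennreal (norm (g \<zeta>)) \<partial>M) / emeasure M (hyp_ball z s)"
    have "ennreal_powr ?X p \<le> (\<integral>\<^sup>+\<zeta>\<in>hyp_ball z s. ennreal (norm (g \<zeta>) powr p) \<partial>M) / emeasure M (hyp_ball z s)"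
      using fin[of s] s r1 hyp_ball_in_sets[OF M z] by (intro powr_average_le_average_powr p) auto
    also have "\<dots> \<le> ?U"
      unfolding divide_ennreal_def
    proof (intro mult_mono ennreal_inverse_antimono)
      show "emeasure M (hyp_ball z r1) \<le> emeasure M (hyp_ball z s)"
        using s by (intro emeasure_mono hyp_ball_mono hyp_ball_in_sets[OF M z]) auto
      show "(\<integral>\<^sup>+\<zeta>\<in>hyp_ball z s. ennreal (norm (g \<zeta>) powr p) \<partial>M) \<le> (\<integral>\<^sup>+\<zeta>\<in>hyp_ball z r0. ennreal (norm (g \<zeta>) powr p) \<partial>M)"
        using s hyp_ball_mono[of s r0 z]
        by (intro nn_integral_mono mult_left_mono) (auto split: split_indicator)
    qed auto
    finally have "ennreal_powr (ennreal_powr ?X p) (1 / p) \<le> ennreal_powr ?U (1 / p)"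
      using p by (intro ennreal_powr_mono) auto
    then show "?X \<le> ennreal_powr ?U (1 / p)"
      using p by (simp add: ennreal_powr_powr)
  qed
  then have "ennreal_powr (trunc_maximal M r1 r0 g z) p \<le> ennreal_powr (ennreal_powr ?U (1 / p)) p"
    using p by (intro ennreal_powr_mono) auto
  then show ?thesis using p by (simp add: ennreal_powr_powr)
qed

text \<open>The constant is the one from the comparison of measures and does not depend on
  \<open>p\<close>; the case p = 1 is included for the weak type estimate.\<close>

lemma nn_integral_trunc_maximal_powr_le:
  assumes r: "0 < r" and w: "disk_weight \<omega>" and bho: "\<omega> \<in> BHO r" and r1: "0 < r1" "r1 < r0"
  obtains C where "0 < C" "\<And>p (g :: complex \<Rightarrow> complex). 1 \<le> p \<Longrightarrow> g \<in> borel_measurable (weighted_area \<omega>) \<Longrightarrow>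
    (\<integral>\<^sup>+z. ennreal_powr (trunc_maximal (weighted_area \<omega>) r1 r0 g z) p \<partial>weighted_area \<omega>)
      \<le> ennreal C * (\<integral>\<^sup>+z. ennreal_powr (ennreal (norm (g z))) p \<partial>weighted_area \<omega>)"
proof -
  let ?M = "weighted_area \<omega>"
  note M = sets_weighted_area[of \<omega>]
  have r0: "0 < r0" using r1 by simp
  obtain C where C: "0 < C" "\<And>w z. w \<in> unit_disk \<Longrightarrow> z \<in> hyp_ball w r0 \<Longrightarrow>
      emeasure ?M (hyp_ball w r0) \<le> ennreal C * emeasure ?M (hyp_ball z r1)"
    using emeasure_hyp_ball_doubling[OF r w bho r0 r1(1)] by blast
  note fin = emeasure_hyp_ball_pos_finite[OF r w bho]
  show thesis
  proof
    show "0 < C" by fact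
    fix p :: real and g :: "complex \<Rightarrow> complex" assume p: "1 \<le> p" and g [measurable]: "g \<in> borel_measurable ?M"
    have "(\<integral>\<^sup>+z. ennreal_powr (trunc_maximal ?M r1 r0 g z) p \<partial>?M) \<le>
        (\<integral>\<^sup>+z. (\<integral>\<^sup>+\<zeta>\<in>hyp_ball z r0. ennreal (norm (g \<zeta>) powr p) \<partial>?M) / emeasure ?M (hyp_ball z r1) \<partial>?M)"
      using space_disk_measure[OF M] r1(1)
      by (intro nn_integral_mono trunc_maximal_powr_le[OF M _ p _ fin]) auto
    also have "\<dots> \<le> ennreal C * (\<integral>\<^sup>+z. ennreal (norm (g z) powr p) \<partial>?M)"
      by (intro nn_integral_average_le[OF M sigma_finite_weighted_area[OF w] _ fin[OF r0] C]) auto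
    finally show "(\<integral>\<^sup>+z. ennreal_powr (trunc_maximal ?M r1 r0 g z) p \<partial>?M)
        \<le> ennreal C * (\<integral>\<^sup>+z. ennreal_powr (ennreal (norm (g z))) p \<partial>?M)"
      by (simp add: ennreal_powr_ennreal)
  qed
qed

theorem theorem1p18:
  fixes \<omega> :: "complex \<Rightarrow> real" and r\<^sub>h r\<^sub>0 r\<^sub>1 :: real
  assumes "0 < r\<^sub>h"
    and "disk_weight \<omega>" and "\<omega> \<in> BHO r\<^sub>h"
    and "0 < r\<^sub>1" and "r\<^sub>1 < r\<^sub>0"
  shows "(\<forall>p>1. bounded_on_Lp (weighted_area \<omega>) p (trunc_maximal (weighted_area \<omega>) r\<^sub>1 r\<^sub>0)) \<and>
         weak_type_1_1 (weighted_area \<omega>) (trunc_maximal (weighted_area \<omega>) r\<^sub>1 r\<^sub>0)"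
proof -
  let ?M = "weighted_area \<omega>" and ?T = "trunc_maximal (weighted_area \<omega>) r\<^sub>1 r\<^sub>0"
  note meas = measurable_trunc_maximal[OF sets_weighted_area sigma_finite_weighted_area[OF assms(2)]]
  obtain C where C: "0 < C" "\<And>p (g :: complex \<Rightarrow> complex). 1 \<le> p \<Longrightarrow> g \<in> borel_measurable ?M \<Longrightarrow>
    (\<integral>\<^sup>+z. ennreal_powr (?T g z) p \<partial>?M) \<le> ennreal C * (\<integral>\<^sup>+z. ennreal_powr (ennreal (norm (g z))) p \<partial>?M)"
    using nn_integral_trunc_maximal_powr_le[OF assms] by blast
  \<comment> \<open>Taking p-th roots of the integrated inequality turns \<open>C\<close> into
    C^(1/p).\<close>
  have strong: "Lp_enorm ?M p (?T g) \<le> ennreal (C powr (1 / p)) * Lp_enorm ?M p (\<lambda>x. ennreal (norm (g x)))"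
    if "1 \<le> p" "g \<in> borel_measurable ?M" for p and g :: "complex \<Rightarrow> complex"
    unfolding Lp_enorm_def ennreal_powr_cmult[OF C(1), symmetric]
    using that by (intro ennreal_powr_mono C(2)) auto
  have "bounded_on_Lp ?M p ?T" if "1 < p" for p
    unfolding bounded_on_Lp_def
    using that C(1) by (intro exI[of _ "C powr (1 / p)"]) (auto simp: Lp_space_def intro!: meas strong)
  moreover have "weak_type_1_1 ?M ?T"
    unfolding weak_type_1_1_def
  proof (intro exI[of _ C] conjI ballI allI impI)
    fix g :: "complex \<Rightarrow> complex" and t :: real
    assume "g \<in> Lp_space ?M 1"
    then have g: "g \<in> borel_measurable ?M" by (simp add: Lp_space_def)
    show T [measurable]: "?T g \<in> borel_measurable ?M" using g by (rule meas)
    assume t: "0 < t"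
    \<comment> \<open>Rescaling by 1 / t brings the level set into the form of Markov's inequality,
      which is then combined with the bound for p = 1.\<close>
    have "emeasure ?M {z \<in> space ?M. ennreal t < ?T g z} \<le>
        emeasure ?M {z \<in> space ?M. 1 \<le> ennreal (1 / t) * ?T g z}"
    proof (intro emeasure_mono subsetI)
      fix z assume "z \<in> {z \<in> space ?M. ennreal t < ?T g z}"
      then have "ennreal (1 / t) * ennreal t \<le> ennreal (1 / t) * ?T g z" "z \<in> space ?M"
        by (auto intro: mult_left_mono)
      moreover have "ennreal (1 / t) * ennreal t = 1" using t by (simp flip: ennreal_mult')
      ultimately show "z \<in> {z \<in> space ?M. 1 \<le> ennreal (1 / t) * ?T g z}" by simp
    qed measurable
    also have "\<dots> \<le> ennreal (1 / t) * (\<integral>\<^sup>+z. ?T g z * indicator (space ?M) z \<partial>?M)"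
      by (rule nn_integral_Markov_inequality) auto
    also have "(\<integral>\<^sup>+z. ?T g z * indicator (space ?M) z \<partial>?M) = (\<integral>\<^sup>+z. ?T g z \<partial>?M)"
      by (intro nn_integral_cong) simp
    also have "\<dots> \<le> ennreal C * (\<integral>\<^sup>+z. ennreal (norm (g z)) \<partial>?M)"
      using C(2)[of 1, OF _ g] by simp
    also have "ennreal (1 / t) * (ennreal C * (\<integral>\<^sup>+z. ennreal (norm (g z)) \<partial>?M))
        = ennreal (C / t) * Lp_enorm ?M 1 (\<lambda>x. ennreal (norm (g x)))"
    proof -
      have "ennreal (1 / t) * ennreal C = ennreal (C / t)" using t by (simp flip: ennreal_mult')
      then show ?thesis by (simp add: Lp_enorm_def flip: mult.assoc)
    qed
    finally show "emeasure ?M {z \<in> space ?M. ennreal t < ?T g z} \<le>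
        ennreal (C / t) * Lp_enorm ?M 1 (\<lambda>x. ennreal (norm (g x)))"
      by (simp add: mult_left_mono)
  qed (fact C(1))
  ultimately show ?thesis by blast
qed

end
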